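(* Let $P$ be a set of $n$ points in general position in the plane. Any convex hull thrackle $C(\mathcal{S})$ on $P$ has at most $2n$ convex hulls, i.e. $|\mathcal{S}|\le 2n$.
   Context: Points are in general position if no three are collinear. Given a set $P$ of $n$ points in general position in the plane and a family $\mathcal{S}$ of subsets of $P$ whose convex hulls are pairwise different, let $C(\mathcal{S})=\{\mathrm{Conv}(S):S\in\mathcal{S}\}$, where $\mathrm{Conv}(S)$ is the convex hull of $S$. $C(\mathcal{S})$ is a convex hull thrackle on $P$ if: (1) $C_1\not\subset C_2$ for any two different $C_1,C_2\in C(\mathcal{S})$; (2) $C_1\cap C_2\neq\emptyset$ for any two different $C_1,C_2\in C(\mathcal{S})$; (3) $C_1\cap C_2\cap C_3\subset P$ for any three different $C_1,C_2,C_3\in C(\mathcal{S})$. *)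

theory Defs
  imports "HOL-Analysis.Analysis"
begin

definition in_general_position :: "(real^2) set \<Rightarrow> bool" where
  "in_general_position P \<longleftrightarrow>
     (\<forall>a\<in>P. \<forall>b\<in>P. \<forall>c\<in>P. a \<noteq> b \<and> a \<noteq> c \<and> b \<noteq> c \<longrightarrow> \<not> collinear {a, b, c})"

definition convex_hulls :: "(real^2) set set \<Rightarrow> (real^2) set set" where
  "convex_hulls \<S> = (\<lambda>S. convex hull S) ` \<S>"

(* Non-inclusion is only required of different members, so strict and non-strict
   inclusion give the same first condition. *)
definition convex_hull_thrackle :: "(real^2) set \<Rightarrow> (real^2) set set \<Rightarrow> bool" where
  "convex_hull_thrackle P \<C> \<longleftrightarrow>
     (\<forall>C1\<in>\<C>. \<forall>C2\<in>\<C>. C1 \<noteq> C2 \<longrightarrow> \<not> C1 \<subseteq> C2) \<and>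
     (\<forall>C1\<in>\<C>. \<forall>C2\<in>\<C>. C1 \<noteq> C2 \<longrightarrow> C1 \<inter> C2 \<noteq> {}) \<and>
     (\<forall>C1\<in>\<C>. \<forall>C2\<in>\<C>. \<forall>C3\<in>\<C>. C1 \<noteq> C2 \<and> C1 \<noteq> C3 \<and> C2 \<noteq> C3 \<longrightarrow> C1 \<inter> C2 \<inter> C3 \<subseteq> P)"

end

(* Orient each edge vw of a hull both ways and call the ray from v to w free if no hull of the family
   having v among its points lies, apart from v, strictly to the right of the ray. Of the two rays vw
   and wv at least one is free: otherwise a hull through v strictly right of vw and a hull through w
   strictly left of it would be disjoint. So a hull with at least three vertices has at least three
   free rays along its boundary, and a segment has at least one; count the ray of a segment with
   weight 3. It remains to see that at most 6 units of weight sit at each vertex v.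

   The hulls with vertex v form arcs of directions of length less than pi, and no direction lies in
   three of them, since three hulls meet in a finite set. A direction y is free iff every arc meets the
   closed half turn that begins at y. If only left ends of arcs are free, choose a free end y with at
   most as many free ends within the half turn after it as before it: the arcs of the latter contain -y,
   so there are at most two of them, and at most two arcs end at y itself. A free right end (or a
   segment) put at angle 0 restricts the positions of all other arcs enough for a direct count. *)
theory Submission
  imports Defs
begin

section \<open>Arcs of directions\<close>

lemma card_le_2I:
  assumes "\<And>i j k. i \<in> A \<Longrightarrow> j \<in> A \<Longrightarrow> k \<in> A \<Longrightarrow> i \<noteq> j \<Longrightarrow> i \<noteq> k \<Longrightarrow> j \<noteq> k \<Longrightarrow> False"
  shows "card A \<le> 2"
proof (rule ccontr)
  assume "\<not> card A \<le> 2"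
  then have "3 \<le> card A" by simp
  then obtain T where T: "T \<subseteq> A" "card T = 3" by (meson obtain_subset_with_card_n)
  then obtain i j k where "T = {i, j, k}" "i \<noteq> j" "i \<noteq> k" "j \<noteq> k" by (auto simp: card_3_iff)
  then show False using assms T by blast
qed

lemma card_le_1I:
  assumes "\<And>i j. i \<in> A \<Longrightarrow> j \<in> A \<Longrightarrow> i = j"
  shows "card A \<le> 1"
proof (cases "A = {}")
  case False
  then obtain a where "A = {a}" using assms by blast
  then show ?thesis by simp
qed simp

text \<open>Summed over \<open>A\<close>, out-degrees and in-degrees both count the related pairs,
  so the first cannot exceed the second at every element.\<close>

lemma exists_outdegree_le_indegree:
  assumes "finite A" "A \<noteq> {}"
  shows "\<exists>i\<in>A. card {j \<in> A. r i j} \<le> card {j \<in> A. r j i}"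
proof (rule ccontr)
  assume "\<not> ?thesis"
  then have "(\<Sum>i\<in>A. card {j \<in> A. r j i}) < (\<Sum>i\<in>A. card {j \<in> A. r i j})"
    using assms by (intro sum_strict_mono) auto
  moreover have "(\<Sum>i\<in>A. card {j \<in> A. r j i}) = (\<Sum>i\<in>A. card {j \<in> A. r i j})"
  proof -
    have "(\<Sum>i\<in>A. card {j \<in> A. r j i}) = (\<Sum>i\<in>A. \<Sum>j\<in>A. if r j i then 1 else 0)"
      using assms by (simp add: sum.If_cases Int_def)
    also have "\<dots> = (\<Sum>j\<in>A. \<Sum>i\<in>A. if r j i then 1 else 0)"
      by (rule sum.swap)
    also have "\<dots> = (\<Sum>i\<in>A. card {j \<in> A. r i j})"
      using assms by (simp add: sum.If_cases Int_def)
    finally show ?thesis .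
  qed
  ultimately show False by simp
qed

(* y is reached from x by a counterclockwise turn of less than pi; both angles are in [0, 2 pi). *)
definition ahead :: "real \<Rightarrow> real \<Rightarrow> bool" where
  "ahead x y \<longleftrightarrow> (x < y \<and> y < x + pi) \<or> y < x - pi"

text \<open>Clockwise rotation by \<open>c\<close>, brought back into [0, 2 pi) for angles in that
  range. It serves to put a chosen direction at angle 0.\<close>

definition rot :: "real \<Rightarrow> real \<Rightarrow> real" where
  "rot c x = (if c \<le> x then x - c else x - c + 2 * pi)"

lemma rot_range: "0 \<le> c \<Longrightarrow> c < 2 * pi \<Longrightarrow> 0 \<le> x \<Longrightarrow> x < 2 * pi \<Longrightarrow> 0 \<le> rot c x \<and> rot c x < 2 * pi"
  by (auto simp: rot_def)

lemma rot_self [simp]: "rot c c = 0"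
  by (simp add: rot_def)

lemma rot_eq_iff:
  "0 \<le> x \<Longrightarrow> x < 2 * pi \<Longrightarrow> 0 \<le> y \<Longrightarrow> y < 2 * pi \<Longrightarrow> rot c x = rot c y \<longleftrightarrow> x = y"
  by (auto simp: rot_def)

lemma ahead_rot:
  assumes "0 \<le> x" "x < 2 * pi" "0 \<le> y" "y < 2 * pi"
  shows "ahead (rot c x) (rot c y) \<longleftrightarrow> ahead x y"
  using assms pi_gt_zero unfolding ahead_def rot_def by (smt (verit))

lemma rot_anti_iff:
  assumes "0 \<le> x" "x < 2 * pi" "0 \<le> y" "y < 2 * pi"
  shows "\<bar>rot c x - rot c y\<bar> = pi \<longleftrightarrow> \<bar>x - y\<bar> = pi"
  using assms pi_gt_zero unfolding rot_def by (smt (verit))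

lemma rot_surj:
  assumes "0 \<le> c" "c < 2 * pi" "0 \<le> p" "p < 2 * pi"
  obtains q where "0 \<le> q" "q < 2 * pi" "p = rot c q"
proof (cases "p + c < 2 * pi")
  case True
  then show ?thesis using assms that[of "p + c"] by (simp add: rot_def)
next
  case False
  then show ?thesis using assms that[of "p + c - 2 * pi"] by (simp add: rot_def)
qed

(* Arc i, counterclockwise from s i to e i, is the angle at a common vertex of the i-th hull;
   s i = e i encodes a segment. *)
locale arc_system =
  fixes I :: "'i set" and s e :: "'i \<Rightarrow> real"
  assumes fin: "finite I"
    and s_range: "i \<in> I \<Longrightarrow> 0 \<le> s i \<and> s i < 2 * pi"
    and e_range: "i \<in> I \<Longrightarrow> 0 \<le> e i \<and> e i < 2 * pi"
    and arc: "i \<in> I \<Longrightarrow> s i = e i \<or> ahead (s i) (e i)"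
    and anti_ss: "i \<in> I \<Longrightarrow> j \<in> I \<Longrightarrow> \<bar>s i - s j\<bar> \<noteq> pi"
    and anti_se: "i \<in> I \<Longrightarrow> j \<in> I \<Longrightarrow> \<bar>s i - e j\<bar> \<noteq> pi"
    and anti_ee: "i \<in> I \<Longrightarrow> j \<in> I \<Longrightarrow> \<bar>e i - e j\<bar> \<noteq> pi"
    and depth: "i \<in> I \<Longrightarrow> j \<in> I \<Longrightarrow> k \<in> I \<Longrightarrow> i \<noteq> j \<Longrightarrow> i \<noteq> k \<Longrightarrow> j \<noteq> k \<Longrightarrow>
      0 \<le> p \<Longrightarrow> p < 2 * pi \<Longrightarrow>
      \<exists>l\<in>{i, j, k}. \<not> ((s l = p \<or> ahead (s l) p) \<and> (p = e l \<or> ahead p (e l)))"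
    and degenerate: "i \<in> I \<Longrightarrow> s i = e i \<Longrightarrow> j \<in> I \<Longrightarrow> j \<noteq> i \<Longrightarrow> s j \<noteq> s i \<and> e j \<noteq> s i"
begin

definition covers :: "'i \<Rightarrow> real \<Rightarrow> bool" where
  "covers i p \<longleftrightarrow> (s i = p \<or> ahead (s i) p) \<and> (p = e i \<or> ahead p (e i))"

text \<open>Arcs are shorter than a half turn, so an arc lies strictly to the right of the direction
  \<open>y\<close> exactly when both its ends do. Freeness forbids such arcs.\<close>

definition free :: "real \<Rightarrow> bool" where
  "free y \<longleftrightarrow> (\<forall>i\<in>I. \<not> (ahead (s i) y \<and> ahead (e i) y))"

definition segs :: "'i set" where "segs = {i \<in> I. s i = e i \<and> free (s i)}"
definition starts :: "'i set" where "starts = {i \<in> I. s i \<noteq> e i \<and> free (s i)}"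
definition ends :: "'i set" where "ends = {i \<in> I. s i \<noteq> e i \<and> free (e i)}"

lemma triple:
  assumes "covers i p" "covers j p" "covers k p" "i \<in> I" "j \<in> I" "k \<in> I"
    "i \<noteq> j" "i \<noteq> k" "j \<noteq> k" "0 \<le> p" "p < 2 * pi"
  shows False
  using depth[of i j k p] assms unfolding covers_def by blast

lemma freeD: "free y \<Longrightarrow> i \<in> I \<Longrightarrow> ahead (s i) y \<Longrightarrow> ahead (e i) y \<Longrightarrow> False"
  unfolding free_def by blast

lemma card_covers:
  assumes "0 \<le> p" "p < 2 * pi" "A \<subseteq> I" "\<And>i. i \<in> A \<Longrightarrow> covers i p"
  shows "card A \<le> 2"
  by (rule card_le_2I) (meson assms triple subsetD)

lemma card_covers_other:
  assumes "0 \<le> p" "p < 2 * pi" "A \<subseteq> I - {b}" "\<And>i. i \<in> A \<Longrightarrow> covers i p" "b \<in> I" "covers b p"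
  shows "card A \<le> 1"
  by (rule card_le_1I) (metis assms triple subsetD Diff_iff singletonI)

lemma finite_sub: "finite segs" "finite starts" "finite ends"
  using fin by (auto simp: segs_def starts_def ends_def)

text \<open>A free end \<open>e i\<close> splits the free ends into those before it, those at it and
  those after it. The first two classes have at most two elements each by \<open>depth\<close>, and
  the averaging choice of \<open>i\<close> bounds the third class by the first.\<close>

lemma card_ends_le: "card ends \<le> 6"
proof (cases "ends = {}")
  case False
  obtain i where i: "i \<in> ends"
    and deg: "card {j \<in> ends. ahead (e i) (e j)} \<le> card {j \<in> ends. ahead (e j) (e i)}"
    using exists_outdegree_le_indegree[OF finite_sub(3) False, of "\<lambda>i j. ahead (e i) (e j)"] by blast
  have iI: "i \<in> I" and fi: "free (e i)" using i by (auto simp: ends_def)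
  \<comment> \<open>\<open>p\<close> is the direction opposite to \<open>e i\<close>. An arc ending
    within the half turn before the free direction \<open>e i\<close> cannot also start there, so it
    reaches back across \<open>p\<close>.\<close>
  define p where "p = (if e i < pi then e i + pi else e i - pi)"
  have "card {j \<in> ends. ahead (e j) (e i)} \<le> 2"
  proof (rule card_covers[of p])
    show "0 \<le> p" "p < 2 * pi" using e_range[OF iI] by (auto simp: p_def)
    fix j assume "j \<in> {j \<in> ends. ahead (e j) (e i)}"
    then have j: "j \<in> I" "s j \<noteq> e j" "ahead (e j) (e i)" by (auto simp: ends_def)
    have "\<not> ahead (s j) (e i)" using freeD[OF fi j(1)] j(3) by blast
    moreover have "ahead (s j) (e j)" using arc j by blast
    ultimately show "covers j p"
      using j(3) e_range[OF iI] e_range[OF j(1)] s_range[OF j(1)] anti_se[OF j(1) iI]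
      unfolding covers_def p_def ahead_def by (smt (verit))
  qed (auto simp: ends_def)
  moreover have "card {j \<in> ends. e j = e i} \<le> 2"
  proof (rule card_covers[of "e i"])
    fix j assume "j \<in> {j \<in> ends. e j = e i}"
    then have j: "j \<in> I" "e j = e i" by (auto simp: ends_def)
    then show "covers j (e i)" using arc[OF j(1)] unfolding covers_def by auto
  qed (use e_range[OF iI] in \<open>auto simp: ends_def\<close>)
  moreover have "ends = {j \<in> ends. ahead (e j) (e i)} \<union> {j \<in> ends. e j = e i} \<union> {j \<in> ends. ahead (e i) (e j)}"
  proof -
    have "ahead (e j) (e i) \<or> e j = e i \<or> ahead (e i) (e j)" if "j \<in> ends" for j
      using that e_range[OF iI] e_range[of j] anti_ee[OF iI, of j]
      unfolding ahead_def ends_def by (smt (verit) mem_Collect_eq)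
    then show ?thesis by blast
  qed
  then have "card ends \<le> card {j \<in> ends. ahead (e j) (e i)} + card {j \<in> ends. e j = e i} + card {j \<in> ends. ahead (e i) (e j)}"
    by (metis (no_types, lifting) card_Un_le add_le_mono1 order_trans)
  ultimately show ?thesis using deg by linarith
qed simp

text \<open>The worst case is 3 + 1 + 2: no second free segment, at most one free start and at most
  two free ends remain beside a free segment at angle 0.\<close>

lemma segment_bound:
  assumes c: "c \<in> segs" and c0: "s c = 0"
  shows "3 * card segs + card starts + card ends \<le> 6"
proof -
  have cI: "c \<in> I" and ce: "e c = 0" and fc: "free 0" using c c0 by (auto simp: segs_def)
  \<comment> \<open>The segment at 0 must not lie strictly right of a free direction. This keeps
    free directions of other arcs out of (0, pi); the values 0 and pi are excluded by
    \<open>degenerate\<close> and general position.\<close>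
  have pos: "pi < s i \<or> i = c" if "i \<in> I" "free (s i)" for i
    using freeD[OF that(2) cI] degenerate[OF cI _ that(1)] s_range[OF that(1)] anti_ss[OF that(1) cI] c0 ce
    unfolding ahead_def by (smt (verit))
  have pos': "pi < e i \<or> i = c" if "i \<in> I" "free (e i)" for i
    using freeD[OF that(2) cI] degenerate[OF cI _ that(1)] e_range[OF that(1)] anti_se[OF cI that(1)] c0 ce
    unfolding ahead_def by (smt (verit))
  have "segs = {c}"
  proof -
    have "i = c" if "i \<in> segs" for i
    proof (rule ccontr)
      assume "i \<noteq> c"
      have i: "i \<in> I" "e i = s i" "free (s i)" using that by (auto simp: segs_def)
      show False using freeD[OF fc i(1)] pos[OF i(1,3)] \<open>i \<noteq> c\<close> i(2) unfolding ahead_def by auto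
    qed
    then show ?thesis using c by blast
  qed
  \<comment> \<open>An arc with free start in (pi, 2 pi) must pass through 0, since 0 is free; the
    segment occupies 0 as well.\<close>
  moreover have "card starts \<le> 1"
  proof (rule card_covers_other[of 0 _ c])
    show "starts \<subseteq> I - {c}" using c0 ce by (auto simp: starts_def)
    show "covers c 0" using c0 ce by (simp add: covers_def)
    fix i assume "i \<in> starts"
    then have i: "i \<in> I" "s i \<noteq> e i" "free (s i)" by (auto simp: starts_def)
    then have "i \<noteq> c" using c0 ce by auto
    then have "pi < s i" using pos i by blast
    moreover have "ahead (s i) (e i)" using arc i by blast
    ultimately show "covers i 0"
      using freeD[OF fc i(1)] s_range[OF i(1)] e_range[OF i(1)] anti_se[OF cI i(1)] c0
      unfolding covers_def ahead_def by (smt (verit))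
  qed (use cI in auto)
  \<comment> \<open>An arc with free end in (pi, 2 pi) must start in (0, pi), since 0 is free, and
    so contains pi.\<close>
  moreover have "card ends \<le> 2"
  proof (rule card_covers[of pi])
    fix i assume "i \<in> ends"
    then have i: "i \<in> I" "s i \<noteq> e i" "free (e i)" by (auto simp: ends_def)
    then have "i \<noteq> c" using c0 ce by auto
    then have "pi < e i" using pos' i by blast
    moreover have "ahead (s i) (e i)" using arc i by blast
    ultimately show "covers i pi"
      using freeD[OF fc i(1)] s_range[OF i(1)] e_range[OF i(1)] anti_ss[OF cI i(1)] c0
        degenerate[OF cI _ i(1) \<open>i \<noteq> c\<close>] ce
      unfolding covers_def ahead_def by (smt (verit))
  qed (auto simp: ends_def)
  ultimately show ?thesis by simp
qed

lemma start_bound: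
  assumes b: "b \<in> starts" and b0: "s b = 0"
  shows "card starts + card ends \<le> 6"
proof -
  have bI: "b \<in> I" and be: "e b \<noteq> 0" and fb: "free 0" using b b0 by (auto simp: starts_def)
  have be': "0 < e b" "e b < pi"
    using arc[OF bI] be e_range[OF bI] unfolding b0 ahead_def by auto
  (* Arcs other than b that miss 0 start in (0, pi) because 0 is free. Free directions in (0, pi]
     lie in (0, e b] because b meets the half turn after them; RC and EC collect the ends there,
     and the arcs in ED all contain pi. *)
  define A where "A = {i \<in> I - {b}. covers i 0}"
  define RC where "RC = {i \<in> starts - {b}. \<not> covers i 0}"
  define EC where "EC = {i \<in> ends - {b}. \<not> covers i 0 \<and> e i \<le> pi}"
  define ED where "ED = {i \<in> ends - {b}. \<not> covers i 0 \<and> pi < e i}"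
  have b_covers: "covers b p" if "0 \<le> p" "p \<le> e b" for p
    using that be' unfolding covers_def b0 ahead_def by auto
  have C: "0 < s i" "s i < pi" "s i \<le> e i" "e i < s i + pi"
    if "i \<in> I" "\<not> covers i 0" for i
  proof -
    have "0 < s i \<and> s i < pi \<and> s i \<le> e i \<and> e i < s i + pi"
      using that(2) freeD[OF fb that(1)] arc[OF that(1)] s_range[OF that(1)] e_range[OF that(1)]
        anti_ss[OF bI that(1)] anti_se[OF bI that(1)]
      unfolding covers_def ahead_def b0 by (smt (verit) pi_gt_zero)
    then show "0 < s i" "s i < pi" "s i \<le> e i" "e i < s i + pi" by auto
  qed
  have C_covers: "covers i p" if "i \<in> I" "\<not> covers i 0" "s i \<le> p" "p \<le> e i" for i p
    using C[OF that(1,2)] that(3,4) unfolding covers_def ahead_def by auto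
  have free_le: "y \<le> e b" if "free y" "0 < y" "y < pi" for y
    using freeD[OF that(1) bI] that be' unfolding b0 ahead_def by (smt (verit))
  have RC: "i \<in> I" "\<not> covers i 0" "free (s i)" "s i \<le> e b" "s i \<noteq> e i" "i \<noteq> b" if "i \<in> RC" for i
    using that C[of i] free_le[of "s i"] by (auto simp: RC_def starts_def)
  have EC: "i \<in> I" "\<not> covers i 0" "free (e i)" "e i \<le> e b" "s i \<noteq> e i" "i \<noteq> b" if "i \<in> EC" for i
  proof -
    show *: "i \<in> I" "\<not> covers i 0" "free (e i)" "s i \<noteq> e i" "i \<noteq> b"
      using that by (auto simp: EC_def ends_def)
    have "e i \<noteq> pi" using anti_se[OF bI *(1)] e_range[OF *(1)] b0 by auto
    then show "e i \<le> e b" using C[OF *(1,2)] free_le[OF *(3)] that by (auto simp: EC_def)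
  qed
  have ED: "i \<in> I" "\<not> covers i 0" "free (e i)" "pi < e i" "i \<noteq> b" if "i \<in> ED" for i
    using that by (auto simp: ED_def ends_def)
  have card_A: "card A \<le> 1"
    by (rule card_covers_other[of 0 _ b]) (use bI b_covers[of 0] be' in \<open>auto simp: A_def\<close>)
  have card_ED: "card ED \<le> 2"
    by (rule card_covers[of pi]) (use ED C C_covers in \<open>auto simp: less_imp_le\<close>)
  \<comment> \<open>If arc \<open>i\<close> ended before \<open>s j\<close>, it would lie strictly
    right of this free direction. So \<open>s j\<close> lies in \<open>i\<close>, \<open>j\<close>
    and \<open>b\<close>, against \<open>depth\<close>.\<close>
  have RC_eq: "i = j" if ij: "i \<in> RC" "j \<in> RC" "s i \<le> s j" for i j
  proof (rule ccontr)
    assume ne: "i \<noteq> j"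
    have "s j \<le> e i"
      using freeD[OF RC(3)[OF ij(2)] RC(1)[OF ij(1)]] C[OF RC(1,2)[OF ij(1)]] C[OF RC(1,2)[OF ij(2)]] ij(3)
      unfolding ahead_def by (smt (verit))
    then show False
      using triple[of i "s j" j b] C_covers[OF RC(1,2)[OF ij(1)]] C_covers[OF RC(1,2)[OF ij(2)]]
        b_covers[of "s j"] RC[OF ij(1)] RC[OF ij(2)] C[OF RC(1,2)[OF ij(2)]] ne ij(3) bI
        s_range[OF RC(1)[OF ij(2)]] by auto
  qed
  have card_RC: "card RC \<le> 1"
    by (rule card_le_1I) (metis RC_eq linear)
  \<comment> \<open>The arc with the earlier end would lie strictly right of the later free end.
    Hence the ends coincide, at a point that also lies in \<open>b\<close>.\<close>
  have EC_eq: "i = j" if ij: "i \<in> EC" "j \<in> EC" "e i \<le> e j" for i j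
  proof (rule ccontr)
    assume ne: "i \<noteq> j"
    have "e j = e i"
      using freeD[OF EC(3)[OF ij(2)] EC(1)[OF ij(1)]] C[OF EC(1,2)[OF ij(1)]] EC(4)[OF ij(2)] be' ij(3)
      unfolding ahead_def by (smt (verit))
    then show False
      using triple[of i "e j" j b] C_covers[OF EC(1,2)[OF ij(1)]] C_covers[OF EC(1,2)[OF ij(2)]]
        b_covers[of "e j"] EC[OF ij(1)] EC[OF ij(2)] C[OF EC(1,2)[OF ij(1)]] C[OF EC(1,2)[OF ij(2)]] ne bI
        e_range[OF EC(1)[OF ij(2)]] by auto
  qed
  have card_EC: "card EC \<le> 1"
    by (rule card_le_1I) (metis EC_eq linear)
  \<comment> \<open>Freeness of \<open>s i\<close> forces \<open>s i\<close> \<le>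
    \<open>e j\<close>, and freeness of \<open>e j\<close> then forces \<open>e j\<close> \<le>
    \<open>e i\<close>; so \<open>e j\<close> would lie in three arcs.\<close>
  have RC_EC: "i = j" if ij: "i \<in> RC" "j \<in> EC" for i j
  proof (rule ccontr)
    assume ne: "i \<noteq> j"
    note Ci = C[OF RC(1,2)[OF ij(1)]] and Cj = C[OF EC(1,2)[OF ij(2)]]
    have "s i \<le> e j"
      using freeD[OF RC(3)[OF ij(1)] EC(1)[OF ij(2)]] Ci Cj unfolding ahead_def by (smt (verit))
    moreover have "e j \<le> e i"
      using freeD[OF EC(3)[OF ij(2)] RC(1)[OF ij(1)]] Ci Cj EC(4)[OF ij(2)] be' calculation
      unfolding ahead_def by (smt (verit))
    ultimately show False
      using triple[of i "e j" j b] C_covers[OF RC(1,2)[OF ij(1)]] C_covers[OF EC(1,2)[OF ij(2)]]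
        b_covers[of "e j"] RC[OF ij(1)] EC[OF ij(2)] Cj ne bI e_range[OF EC(1)[OF ij(2)]] by auto
  qed
  (* A free direction y in (0, e b] that lies in a further arc besides b lies in no third one, so every
     other arc starts within the half turn after y. *)
  have beyond_A: "s a \<le> y + pi \<and> pi < s a"
    if "a \<in> A" "free y" "j \<in> I" "j \<noteq> b" "\<not> covers j 0" "covers j y" "0 < y" "y \<le> e b" for a y j
  proof -
    have a: "a \<in> I" "a \<noteq> b" "covers a 0" using that(1) by (auto simp: A_def)
    have "\<not> covers a y"
      using triple[of a y j b] a that b_covers[of y] bI be' by auto
    then show ?thesis
      using a(3) freeD[OF that(2) a(1)] s_range[OF a(1)] e_range[OF a(1)] that(7,8) be' arc[OF a(1)]
        anti_ss[OF bI a(1)] anti_se[OF bI a(1)] b0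
      unfolding covers_def ahead_def by (smt (verit))
  qed
  have beyond_ED: "y \<le> s d"
    if "d \<in> ED" "free y" "j \<in> I" "j \<noteq> b" "\<not> covers j 0" "covers j y" "0 < y" "y \<le> e b" "d = j \<longrightarrow> y = s j" for d y j
  proof (cases "d = j")
    case False
    have "\<not> covers d y"
      using triple[of d y j b] False ED[OF that(1)] that b_covers[of y] bI be' by auto
    then show ?thesis
      using C_covers[OF ED(1,2)[OF that(1)], of y] ED(4)[OF that(1)] that(8) be' by linarith
  qed (use that(9) in simp)
  \<comment> \<open>Both ends of arc \<open>i\<close> are free here. Since \<open>s a\<close> lies
    in (pi, \<open>s i + pi\<close>], the arc \<open>i\<close> is strictly right of
    \<open>s a\<close>, so \<open>s a\<close> is not free. All arcs in \<open>ED\<close> contain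
    \<open>s i + pi\<close>, the direction opposite to \<open>s i\<close>, and so does
    \<open>a\<close>.\<close>
  have nested: "a \<notin> starts" "card ED \<le> 1" if "i \<in> RC" "i \<in> EC" "a \<in> A" for i a
  proof -
    note Ci = C[OF RC(1,2)[OF that(1)]]
    have a: "a \<in> I" "a \<noteq> b" "covers a 0" using that(3) by (auto simp: A_def)
    have ba: "s a \<le> s i + pi \<and> pi < s a"
      using beyond_A[OF that(3) RC(3,1,6,2)[OF that(1)] C_covers[OF RC(1,2)[OF that(1)]]] Ci RC(4)[OF that(1)] by simp
    show "a \<notin> starts"
    proof
      assume "a \<in> starts"
      then have "free (s a)" by (auto simp: starts_def)
      then show False
        using freeD[OF _ RC(1)[OF that(1)], of "s a"] ba Ci EC(4)[OF that(2)] be' s_range[OF a(1)] anti_ss[OF a(1) RC(1)[OF that(1)]]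
        unfolding ahead_def by (smt (verit))
    qed
    show "card ED \<le> 1"
    proof (rule card_covers_other[of "s i + pi" _ a])
      show "ED \<subseteq> I - {a}" using ED a by auto
      show "covers a (s i + pi)"
        using a(3) ba Ci s_range[OF a(1)] e_range[OF a(1)] arc[OF a(1)] unfolding covers_def ahead_def by (smt (verit))
      fix d assume d: "d \<in> ED"
      have "s i \<le> s d"
        using beyond_ED[OF d RC(3,1,6,2)[OF that(1)] C_covers[OF RC(1,2)[OF that(1)]]] Ci RC(4)[OF that(1)] by simp
      moreover have "e d > e i + pi \<or> e d > s i + pi"
        using freeD[OF ED(3)[OF d] RC(1)[OF that(1)]] ED(4)[OF d] Ci EC(4)[OF that(2)] be' e_range[OF ED(1)[OF d]]
          anti_se[OF RC(1)[OF that(1)] ED(1)[OF d]]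
        unfolding ahead_def by (smt (verit))
      ultimately show "covers d (s i + pi)"
        using C_covers[OF ED(1,2)[OF d], of "s i + pi"] C[OF ED(1,2)[OF d]] Ci by linarith
    qed (use a Ci in auto)
  qed
  \<comment> \<open>Here \<open>s a\<close> is free and at most a half turn after \<open>y\<close>,
    while every arc in \<open>ED\<close> starts at or after \<open>y\<close>. Each of them must
    therefore reach \<open>s a\<close>, which \<open>a\<close> occupies already.\<close>
  have partial: "card ED \<le> 1" if a: "a \<in> A" "a \<in> starts" and ne: "RC \<union> EC \<noteq> {}" for a
  proof -
    have aI: "a \<in> I" "a \<noteq> b" "covers a 0" using a(1) by (auto simp: A_def)
    have fa: "free (s a)" using a(2) by (auto simp: starts_def)
    obtain j y where j: "free y" "j \<in> I" "j \<noteq> b" "\<not> covers j 0" "covers j y" "0 < y" "y \<le> e b"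
      and y: "y = s j \<or> j \<notin> ED"
    proof -
      consider i where "i \<in> RC" | i where "i \<in> EC" using ne by auto
      then show thesis
      proof cases
        case (1 i)
        then show thesis
          using that[of "s i" i] RC[OF 1] C[OF RC(1,2)[OF 1]] C_covers[OF RC(1,2)[OF 1], of "s i"] by auto
      next
        case (2 i)
        then have "i \<notin> ED" by (auto simp: EC_def ED_def)
        then show thesis
          using that[of "e i" i] EC[OF 2] C[OF EC(1,2)[OF 2]] C_covers[OF EC(1,2)[OF 2], of "e i"] by auto
      qed
    qed
    have ba: "s a \<le> y + pi \<and> pi < s a" by (rule beyond_A[OF a(1) j])
    show ?thesis
    proof (rule card_covers_other[of "s a" _ a])
      show "ED \<subseteq> I - {a}" using ED aI by auto
      show "covers a (s a)" using arc[OF aI(1)] by (auto simp: covers_def)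
      fix d assume d: "d \<in> ED"
      have "y \<le> s d" using beyond_ED[OF d j] d y by blast
      then have "\<not> s d < s a - pi" using ba by linarith
      then have "s a \<le> e d"
        using freeD[OF fa ED(1)[OF d]] ba C[OF ED(1,2)[OF d]] ED(4)[OF d] s_range[OF aI(1)] anti_ss[OF aI(1) ED(1)[OF d]]
        unfolding ahead_def by (smt (verit))
      then show "covers d (s a)" using C_covers[OF ED(1,2)[OF d]] C[OF ED(1,2)[OF d]] ba by simp
    qed (use aI s_range[OF aI(1)] in auto)
  qed
  have fins: "finite A" "finite RC" "finite EC" "finite ED"
    using fin finite_sub by (auto simp: A_def RC_def EC_def ED_def)
  have "starts \<subseteq> insert b (starts \<inter> A \<union> RC)" by (auto simp: A_def RC_def starts_def)
  then have "card starts \<le> card (insert b (starts \<inter> A \<union> RC))"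
    by (intro card_mono) (auto simp: fins)
  also have "\<dots> \<le> 1 + card (starts \<inter> A) + card RC"
    using card_insert_le_m1 card_Un_le[of "starts \<inter> A" RC] by (simp add: card_insert_if fins)
  finally have cs: "card starts \<le> 1 + card (starts \<inter> A) + card RC" .
  have "ends \<subseteq> insert b (A \<union> EC \<union> ED)" by (auto simp: A_def EC_def ED_def ends_def)
  then have "card ends \<le> card (insert b (A \<union> EC \<union> ED))"
    by (intro card_mono) (auto simp: fins)
  also have "\<dots> \<le> 1 + card A + card EC + card ED"
    using card_Un_le[of "A \<union> EC" ED] card_Un_le[of A EC] by (simp add: card_insert_if fins)
  finally have ce: "card ends \<le> 1 + card A + card EC + card ED" .
  have sA: "card (starts \<inter> A) \<le> card A" by (intro card_mono fins) auto
  \<comment> \<open>By \<open>cs\<close> and \<open>ce\<close> the total is at most 2 plus the sizes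
    of \<open>starts\<close> \<inter> \<open>A\<close>, \<open>A\<close>, \<open>RC\<close>,
    \<open>EC\<close> and \<open>ED\<close>. This is at most 6 if \<open>A\<close> is empty;
    otherwise \<open>nested\<close> or \<open>partial\<close> must save up to two units.\<close>
  show ?thesis
  proof (cases "A = {}")
    case True
    then show ?thesis using cs ce card_ED card_RC card_EC by simp
  next
    case False
    then obtain a where a: "a \<in> A" by blast
    then have A: "A = {a}" using card_A fins(1) by (metis card_le_Suc0_iff_eq One_nat_def singleton_iff subsetI subset_antisym singletonD)
    consider i where "i \<in> RC" "i \<in> EC" | "RC = {} \<or> EC = {}" using RC_EC by blast
    then show ?thesis
    proof cases
      case (1 i)
      then have "starts \<inter> A = {}" "card ED \<le> 1" using nested[OF 1 a] A by auto
      then show ?thesis using cs ce card_A card_RC card_EC by simp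
    next
      case 2
      show ?thesis
      proof (cases "a \<in> starts \<and> RC \<union> EC \<noteq> {}")
        case True
        then show ?thesis using partial[OF a] 2 cs ce sA card_A card_RC card_EC by auto
      next
        case False
        then have "starts \<inter> A = {} \<or> RC = {} \<and> EC = {}" using A by auto
        then show ?thesis using 2 cs ce sA card_A card_RC card_EC card_ED by auto
      qed
    qed
  qed
qed

text \<open>All conditions on an arc system are invariant under rotation, so the bounds proved for a
  direction at angle 0 hold for any direction.\<close>

lemma rotate:
  assumes c: "0 \<le> c" "c < 2 * pi"
  shows "arc_system I (\<lambda>i. rot c (s i)) (\<lambda>i. rot c (e i))"
proof
  fix i j k :: 'i and p :: real
  assume ijk: "i \<in> I" "j \<in> I" "k \<in> I" "i \<noteq> j" "i \<noteq> k" "j \<noteq> k" and p: "0 \<le> p" "p < 2 * pi"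
  obtain q where q: "0 \<le> q" "q < 2 * pi" "p = rot c q" using rot_surj[OF c p] .
  have "((rot c (s l) = p \<or> ahead (rot c (s l)) p) \<and> (p = rot c (e l) \<or> ahead p (rot c (e l)))) \<longleftrightarrow>
     ((s l = q \<or> ahead (s l) q) \<and> (q = e l \<or> ahead q (e l)))" if "l \<in> I" for l
    using s_range[OF that] e_range[OF that] q by (simp add: rot_eq_iff ahead_rot)
  then show "\<exists>l\<in>{i, j, k}. \<not> ((rot c (s l) = p \<or> ahead (rot c (s l)) p) \<and> (p = rot c (e l) \<or> ahead p (rot c (e l))))"
    using depth[OF ijk q(1,2)] ijk by blast
qed (use c s_range e_range arc anti_ss anti_se anti_ee degenerate fin in
      \<open>simp_all add: rot_range rot_eq_iff ahead_rot rot_anti_iff\<close>)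

lemma rotate_sets:
  assumes c: "0 \<le> c" "c < 2 * pi"
  shows "arc_system.segs I (\<lambda>i. rot c (s i)) (\<lambda>i. rot c (e i)) = segs"
    "arc_system.starts I (\<lambda>i. rot c (s i)) (\<lambda>i. rot c (e i)) = starts"
    "arc_system.ends I (\<lambda>i. rot c (s i)) (\<lambda>i. rot c (e i)) = ends"
proof -
  interpret r: arc_system I "\<lambda>i. rot c (s i)" "\<lambda>i. rot c (e i)" by (rule rotate[OF c])
  have "r.free (rot c y) = free y" if "0 \<le> y" "y < 2 * pi" for y
    using that s_range e_range by (auto simp: r.free_def free_def ahead_rot)
  then show "r.segs = segs" "r.starts = starts" "r.ends = ends"
    using s_range e_range
    by (auto simp: r.segs_def segs_def r.starts_def starts_def r.ends_def ends_def rot_eq_iff)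
qed

theorem weight_le_6: "3 * card segs + card starts + card ends \<le> 6"
proof (cases "segs = {}")
  case False
  then obtain c where c: "c \<in> segs" by blast
  then have cr: "0 \<le> s c" "s c < 2 * pi" using s_range[of c] by (simp_all add: segs_def)
  show ?thesis
    using arc_system.segment_bound[OF rotate[OF cr], of c] c by (simp add: rotate_sets[OF cr])
next
  case segs: True
  show ?thesis
  proof (cases "starts = {}")
    case True
    then show ?thesis using segs card_ends_le by simp
  next
    case False
    then obtain b where b: "b \<in> starts" by blast
    then have br: "0 \<le> s b" "s b < 2 * pi" using s_range by (auto simp: starts_def)
    show ?thesis
      using arc_system.start_bound[OF rotate[OF br], of b] b segs by (simp add: rotate_sets[OF br])
  qed
qed

end

section \<open>Orientation in the plane\<close>

text \<open>The determinant of two vectors: positive when \<open>b\<close> lies to the left of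
  \<open>a\<close>, zero when they are parallel.\<close>

definition wedge :: "real^2 \<Rightarrow> real^2 \<Rightarrow> real" where
  "wedge a b = a$1 * b$2 - a$2 * b$1"

definition ang :: "real^2 \<Rightarrow> real" where
  "ang x = Arg2pi (Complex (x$1) (x$2))"

lemma wedge_swap: "wedge a b = - wedge b a"
  by (simp add: wedge_def)

lemma wedge_self [simp]: "wedge a a = 0"
  by (simp add: wedge_def)

lemma wedge_zero [simp]: "wedge a 0 = 0" "wedge 0 a = 0"
  by (simp_all add: wedge_def)

lemma wedge_reverse: "wedge (v - w) (x - w) = - wedge (w - v) (x - v)"
  by (simp add: wedge_def algebra_simps)

lemma wedge_minus_left: "wedge (v - u) x = - wedge (u - v) x"
  by (simp add: wedge_def algebra_simps)

text \<open>The three-term Grassmann-Pluecker relation.\<close>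

lemma wedge_pluecker: "wedge q w * wedge y x = wedge q y * wedge w x + wedge q x * wedge y w"
  by (simp add: wedge_def algebra_simps)

text \<open>Cramer's rule for writing \<open>d\<close> in terms of \<open>w\<close> and
  \<open>u\<close>.\<close>

lemma wedge_expand: "wedge w u *\<^sub>R d = wedge d u *\<^sub>R w + wedge w d *\<^sub>R u"
  by (simp add: vec_eq_iff forall_2 wedge_def algebra_simps)

lemma vec2_nonzero: "x \<noteq> 0 \<Longrightarrow> x$1 \<noteq> 0 \<or> x$2 \<noteq> (0::real)" for x :: "real^2"
  by (auto simp: vec_eq_iff forall_2)

lemma ang_range: "0 \<le> ang x" "ang x < 2 * pi"
  by (simp_all add: ang_def Arg2pi_ge_0 Arg2pi_lt_2pi)

lemma polar:
  assumes "x \<noteq> 0"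
  obtains r where "r > 0" "x$1 = r * cos (ang x)" "x$2 = r * sin (ang x)"
proof -
  define z where "z = Complex (x$1) (x$2)"
  have "z \<noteq> 0" using vec2_nonzero[OF assms] by (auto simp: z_def complex_eq_iff)
  then have r: "cmod z > 0" by simp
  have z: "z = of_real (cmod z) * cis (ang x)"
    unfolding ang_def cis_conv_exp z_def[symmetric] by (rule Arg2pi_eq)
  have "Re z = cmod z * cos (ang x)" "Im z = cmod z * sin (ang x)"
    by (subst z, simp)+
  moreover have "Re z = x$1" "Im z = x$2" by (simp_all add: z_def)
  ultimately show ?thesis by (intro that[OF r]) (metis, metis)
qed

text \<open>The sine of a difference ignores full turns, so its sign matches the cyclic relation
  \<open>ahead\<close>. This is the bridge between \<open>wedge\<close> and angles.\<close>

lemma sin_pos_iff: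
  assumes "0 \<le> x" "x < 2 * pi" "0 \<le> y" "y < 2 * pi"
  shows "sin (y - x) > 0 \<longleftrightarrow> ahead x y"
    and "sin (y - x) = 0 \<longleftrightarrow> x = y \<or> \<bar>x - y\<bar> = pi"
proof -
  have pos: "sin (b - a) > 0" if "ahead a b" "0 \<le> b" "a < 2 * pi" for a b
    using that(1) unfolding ahead_def
  proof
    assume "b < a - pi"
    then show ?thesis using sin_gt_zero[of "b - a + 2 * pi"] that by simp
  qed (simp add: sin_gt_zero)
  have neg: "sin (y - x) < 0" if "ahead y x"
    using pos[OF that] assms sin_minus[of "x - y"] by simp
  have zero: "sin (y - x) = 0" if "x = y \<or> x - y = pi \<or> x - y = - pi"
  proof -
    have "y = x \<or> y = x - pi \<or> y = x + pi" using that by auto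
    then show ?thesis by (elim disjE) simp_all
  qed
  have anti: "\<bar>x - y\<bar> = pi \<longleftrightarrow> x - y = pi \<or> x - y = - pi"
    using pi_gt_zero by linarith
  have excl: "\<not> (ahead x y \<and> ahead y x)" "ahead x y \<or> ahead y x \<Longrightarrow> x \<noteq> y \<and> x - y \<noteq> pi \<and> x - y \<noteq> - pi"
    using assms pi_gt_zero unfolding ahead_def by linarith+
  have "ahead x y \<or> ahead y x \<or> x = y \<or> x - y = pi \<or> x - y = - pi"
    unfolding ahead_def by linarith
  then consider "ahead x y" | "ahead y x" | "x = y \<or> x - y = pi \<or> x - y = - pi" by blast
  then have "(sin (y - x) > 0 \<longleftrightarrow> ahead x y) \<and> (sin (y - x) = 0 \<longleftrightarrow> x = y \<or> \<bar>x - y\<bar> = pi)"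
  proof cases
    case 1
    then have "sin (y - x) > 0" using pos assms by blast
    then show ?thesis using excl 1 unfolding anti by simp
  next
    case 2
    then have "sin (y - x) < 0" using neg by blast
    then show ?thesis using excl 2 unfolding anti by simp
  next
    case 3
    then have "sin (y - x) = 0" using zero by blast
    then show ?thesis using excl(2) 3 unfolding anti by (metis less_irrefl)
  qed
  then show "sin (y - x) > 0 \<longleftrightarrow> ahead x y" "sin (y - x) = 0 \<longleftrightarrow> x = y \<or> \<bar>x - y\<bar> = pi"
    by blast+
qed

section \<open>Determinants in terms of angles\<close>

lemma wedge_ang:
  assumes "x \<noteq> 0" "y \<noteq> 0"
  obtains r where "r > 0" "wedge x y = r * sin (ang y - ang x)"
proof -
  obtain r where r: "r > 0" "x$1 = r * cos (ang x)" "x$2 = r * sin (ang x)" using polar[OF assms(1)] .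
  obtain t where t: "t > 0" "y$1 = t * cos (ang y)" "y$2 = t * sin (ang y)" using polar[OF assms(2)] .
  have "wedge x y = (r * t) * sin (ang y - ang x)"
    unfolding wedge_def sin_diff r(2,3) t(2,3) by (simp only: algebra_simps)
  then show ?thesis using that[of "r * t"] mult_pos_pos[OF r(1) t(1)] by blast
qed

lemma wedge_pos_iff:
  assumes "x \<noteq> 0" "y \<noteq> 0"
  shows "0 < wedge x y \<longleftrightarrow> ahead (ang x) (ang y)"
proof -
  obtain r where "r > 0" "wedge x y = r * sin (ang y - ang x)" using wedge_ang[OF assms] .
  then show ?thesis using sin_pos_iff(1)[of "ang x" "ang y"] ang_range by (simp add: zero_less_mult_iff)
qed

lemma wedge_zero_iff:
  assumes "x \<noteq> 0" "y \<noteq> 0"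
  shows "wedge x y = 0 \<longleftrightarrow> ang x = ang y \<or> \<bar>ang x - ang y\<bar> = pi"
proof -
  obtain r where "r > 0" "wedge x y = r * sin (ang y - ang x)" using wedge_ang[OF assms] .
  then show ?thesis using sin_pos_iff(2)[of "ang x" "ang y"] ang_range by simp
qed

definition dir :: "real \<Rightarrow> real^2" where "dir p = vector [cos p, sin p]"

lemma dir_nonzero: "dir p \<noteq> 0"
proof
  assume "dir p = 0"
  then have "cos p = 0" "sin p = 0" by (simp_all add: dir_def vec_eq_iff forall_2)
  then show False using sin_cos_squared_add[of p] by simp
qed

lemma ang_dir: "0 \<le> p \<Longrightarrow> p < 2 * pi \<Longrightarrow> ang (dir p) = p"
  unfolding ang_def dir_def
  by (rule Arg2pi_unique[of 1]) (auto simp: complex_eq_iff Re_exp Im_exp)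

lemma ang_eq_imp:
  assumes "x \<noteq> 0" "y \<noteq> 0" "ang x = ang y"
  obtains c where "c > 0" "y = c *\<^sub>R x"
proof -
  obtain r where r: "r > 0" "x$1 = r * cos (ang x)" "x$2 = r * sin (ang x)" using polar[OF assms(1)] .
  obtain t where t: "t > 0" "y$1 = t * cos (ang y)" "y$2 = t * sin (ang y)" using polar[OF assms(2)] .
  have "y = (t / r) *\<^sub>R x" using r t assms(3) by (simp add: vec_eq_iff forall_2)
  then show ?thesis using that[of "t / r"] divide_pos_pos[OF t(1) r(1)] by blast
qed

text \<open>Strictly inside the arc the coefficients come from Cramer's rule and have the signs of
  determinants. The two boundary directions are treated apart, which also covers a degenerate
  cone.\<close>

lemma cone_contains_dir:
  assumes "w \<noteq> 0" "u \<noteq> 0" "0 \<le> p" "p < 2 * pi"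
    and "ang w = ang u \<or> ahead (ang w) (ang u)"
    and "ang w = p \<or> ahead (ang w) p" "p = ang u \<or> ahead p (ang u)"
  obtains \<alpha> \<beta> where "\<alpha> \<ge> 0" "\<beta> \<ge> 0" "dir p = \<alpha> *\<^sub>R w + \<beta> *\<^sub>R u"
proof (cases "ang w = p")
  case True
  then obtain c where "c > 0" "dir p = c *\<^sub>R w"
    using ang_eq_imp[OF assms(1) dir_nonzero] ang_dir[OF assms(3,4)] by metis
  then show ?thesis using that[of c 0] by simp
next
  case False
  show ?thesis
  proof (cases "p = ang u")
    case True
    then obtain c where "c > 0" "dir p = c *\<^sub>R u"
      using ang_eq_imp[OF assms(2) dir_nonzero] ang_dir[OF assms(3,4)] by metis
    then show ?thesis using that[of 0 c] by simp
  next
    case pu: False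
    have wd: "wedge w (dir p) > 0" "wedge (dir p) u > 0"
      using assms False pu by (simp_all add: wedge_pos_iff dir_nonzero ang_dir)
    have "ang w \<noteq> ang u" using assms(6,7) False pu unfolding ahead_def by (smt (verit) pi_gt_zero)
    then have wu: "wedge w u > 0" using assms by (simp add: wedge_pos_iff)
    have "dir p = (1 / wedge w u) *\<^sub>R (wedge w u *\<^sub>R dir p)" using wu by simp
    also have "\<dots> = (wedge (dir p) u / wedge w u) *\<^sub>R w + (wedge w (dir p) / wedge w u) *\<^sub>R u"
      by (subst wedge_expand) (simp add: scaleR_right_distrib)
    finally show ?thesis
      by (intro that[OF divide_nonneg_pos divide_nonneg_pos]) (use wd wu in simp_all)
  qed
qed

section \<open>Collinearity, half-planes and extreme directions\<close>

lemma wedge_zero_parallel: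
  assumes "x \<noteq> 0" "wedge x y = 0"
  shows "\<exists>k. y = k *\<^sub>R x"
  using vec2_nonzero[OF assms(1)]
proof
  assume "x$1 \<noteq> 0"
  then have "y = (y$1 / x$1) *\<^sub>R x"
    using assms(2) by (simp add: vec_eq_iff forall_2 wedge_def field_simps)
  then show ?thesis ..
next
  assume "x$2 \<noteq> 0"
  then have "y = (y$2 / x$2) *\<^sub>R x"
    using assms(2) by (simp add: vec_eq_iff forall_2 wedge_def field_simps)
  then show ?thesis ..
qed

lemma wedge_zero_collinear:
  assumes "wedge (b - a) (c - a) = 0"
  shows "collinear {a, b, c}"
proof (cases "b = a")
  case False
  then have "\<exists>k. c - a = k *\<^sub>R (b - a)" using wedge_zero_parallel assms by simp
  then have "collinear {0, b - a, c - a}" by (auto simp: collinear_lemma)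
  then have "collinear {b, a, c}" by (simp add: collinear_3)
  then show ?thesis by (simp add: insert_commute)
qed simp

text \<open>A proper convex combination of two points of this set stays strictly inside unless both
  are \<open>v\<close>. The set encloses a hull that lies, apart from \<open>v\<close>, strictly to
  the right of a ray from \<open>v\<close>.\<close>

lemma convex_insert_halfplane:
  "convex (insert v {z. wedge d (z - v) < 0})"
proof (rule convexI)
  have w: "wedge d (u *\<^sub>R x + t *\<^sub>R y - v) = u * wedge d (x - v) + t * wedge d (y - v)" if "u + t = 1" for u t x y
  proof -
    have t: "t = 1 - u" using that by simp
    show ?thesis unfolding t wedge_def by (simp add: algebra_simps)
  qed
  fix x y and u t :: real
  assume xy: "x \<in> insert v {z. wedge d (z - v) < 0}" "y \<in> insert v {z. wedge d (z - v) < 0}"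
    and ut: "0 \<le> u" "0 \<le> t" "u + t = 1"
  consider "x = v" "y = v" | "u = 0" | "t = 0" | "u > 0" "t > 0" "x \<noteq> v \<or> y \<noteq> v" using ut by fastforce
  then show "u *\<^sub>R x + t *\<^sub>R y \<in> insert v {z. wedge d (z - v) < 0}"
  proof cases
    case 1
    then show ?thesis using ut by (simp flip: scaleR_add_left)
  next
    case 4
    have "wedge d (x - v) \<le> 0" "wedge d (y - v) \<le> 0" "wedge d (x - v) < 0 \<or> wedge d (y - v) < 0"
      using xy 4(3) by (auto simp: wedge_def)
    then have "u * wedge d (x - v) + t * wedge d (y - v) < 0"
      using 4(1,2) by (smt (verit) mult_pos_neg mult_nonneg_nonpos)
    then show ?thesis using w[OF ut(3)] by simp
  qed (use xy ut in auto)
qed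

text \<open>The hulls lie in the two open sides of the line through \<open>v\<close> and
  \<open>w\<close>, enlarged by \<open>v\<close> and by \<open>w\<close> respectively.\<close>

lemma disjoint_hulls:
  assumes "v \<noteq> w" "\<And>x. x \<in> S - {v} \<Longrightarrow> wedge (w - v) (x - v) < 0"
    "\<And>x. x \<in> T - {w} \<Longrightarrow> wedge (v - w) (x - w) < 0"
  shows "convex hull S \<inter> convex hull T = {}"
proof -
  have "convex hull S \<subseteq> insert v {z. wedge (w - v) (z - v) < 0}"
    using assms(2) by (intro hull_minimal convex_insert_halfplane) auto
  moreover have "convex hull T \<subseteq> insert w {z. wedge (v - w) (z - w) < 0}"
    using assms(3) by (intro hull_minimal convex_insert_halfplane) auto
  ultimately show ?thesis
    using assms(1) wedge_reverse[of v w] wedge_reverse[of w v] wedge_self[of "w - v"]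
    by (fastforce simp: wedge_def)
qed

text \<open>Boundary edges directed counterclockwise. For a two-point set both orientations of its
  segment are edges.\<close>

definition edge :: "(real^2) set \<Rightarrow> real^2 \<Rightarrow> real^2 \<Rightarrow> bool" where
  "edge S v w \<longleftrightarrow> v \<in> S \<and> w \<in> S \<and> v \<noteq> w \<and> (\<forall>x\<in>S. 0 \<le> wedge (w - v) (x - v))"

lemma edge_reverse:
  "edge S u v \<longleftrightarrow> u \<in> S \<and> v \<in> S \<and> u \<noteq> v \<and> (\<forall>x\<in>S. wedge (u - v) (x - v) \<le> 0)"
  using wedge_reverse[of v u] by (auto simp: edge_def)

(* \<sigma> = 1 and \<sigma> = -1 give the two extreme directions. *)
lemma extreme_direction:
  fixes \<sigma> :: real
  assumes "finite T" "T \<noteq> {}" "q \<noteq> 0" "\<And>x. x \<in> T \<Longrightarrow> 0 \<le> \<sigma> * wedge q x" "\<sigma> \<noteq> 0"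
    and "\<And>x y. x \<in> T \<Longrightarrow> y \<in> T \<Longrightarrow> wedge x y = 0 \<Longrightarrow> x = y"
  shows "\<exists>w\<in>T. \<forall>x\<in>T. 0 \<le> \<sigma> * wedge w x"
  using assms(1,2,4,6)
proof (induction T rule: finite_ne_induct)
  case (insert y T)
  then obtain w where w: "w \<in> T" "\<forall>x\<in>T. 0 \<le> \<sigma> * wedge w x" by auto
  show ?case
  proof (cases "0 \<le> \<sigma> * wedge w y")
    case True
    then show ?thesis using w by auto
  next
    case False
    then have yw: "0 < \<sigma> * wedge y w" using wedge_swap[of w y] by simp
    have "0 \<le> \<sigma> * wedge y x" if x: "x \<in> T" for x
    proof -
      \<comment> \<open>Seen from \<open>q\<close>, all directions lie in one closed half-plane,
        which makes the comparison by \<open>wedge\<close> transitive: the right-hand side consists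
        of nonnegative terms.\<close>
      have pl: "(\<sigma> * wedge q w) * (\<sigma> * wedge y x) =
        (\<sigma> * wedge q y) * (\<sigma> * wedge w x) + (\<sigma> * wedge q x) * (\<sigma> * wedge y w)"
        using arg_cong[OF wedge_pluecker[of q w y x], of "\<lambda>t. \<sigma> * \<sigma> * t"] by (simp add: algebra_simps)
      have nn: "0 \<le> (\<sigma> * wedge q y) * (\<sigma> * wedge w x)" "0 \<le> (\<sigma> * wedge q x) * (\<sigma> * wedge y w)"
        using insert.prems(1) w x yw by (auto intro!: mult_nonneg_nonneg)
      show ?thesis
      proof (cases "\<sigma> * wedge q w = 0")
        \<comment> \<open>The factor of \<open>wedge y x\<close> vanishes, so the sign must come
          differently: \<open>w\<close> and \<open>x\<close> are both parallel to \<open>q\<close>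
          and hence equal.\<close>
        case True
        then have "0 = (\<sigma> * wedge q y) * (\<sigma> * wedge w x) + (\<sigma> * wedge q x) * (\<sigma> * wedge y w)"
          using pl by (metis mult_zero_left)
        then have "(\<sigma> * wedge q x) * (\<sigma> * wedge y w) = 0" using nn by linarith
        then have qx: "wedge q x = 0" using yw assms(5) by auto
        have qw: "wedge q w = 0" using True assms(5) by simp
        have "q$1 * wedge w x = 0" "q$2 * wedge w x = 0"
          using qx qw unfolding wedge_def by algebra+
        then have "wedge w x = 0" using vec2_nonzero[OF assms(3)] by auto
        then have "w = x" using insert.prems(2) w x by blast
        then show ?thesis using yw by simp
      next
        case False
        moreover have "0 \<le> \<sigma> * wedge q w" using insert.prems(1) w(1) by blast
        ultimately have "0 < \<sigma> * wedge q w" by linarith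
        then show ?thesis using pl nn by (smt (verit) mult_pos_neg)
      qed
    qed
    then show ?thesis by auto
  qed
qed simp

section \<open>Edges of the hulls\<close>

text \<open>The family is indexed by point sets rather than by hulls. Sets with fewer than two
  points have no edges and are treated separately in the final theorem.\<close>

locale hull_thrackle =
  fixes P :: "(real^2) set" and SS :: "(real^2) set set"
  assumes finP: "finite P"
    and gp: "a \<in> P \<Longrightarrow> b \<in> P \<Longrightarrow> c \<in> P \<Longrightarrow> a \<noteq> b \<Longrightarrow> a \<noteq> c \<Longrightarrow> b \<noteq> c \<Longrightarrow> \<not> collinear {a, b, c}"
    and sub: "S \<in> SS \<Longrightarrow> S \<subseteq> P"
    and two: "S \<in> SS \<Longrightarrow> 2 \<le> card S"
    and noincl: "S \<in> SS \<Longrightarrow> T \<in> SS \<Longrightarrow> S \<noteq> T \<Longrightarrow> \<not> convex hull S \<subseteq> convex hull T"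
    and meet: "S \<in> SS \<Longrightarrow> T \<in> SS \<Longrightarrow> S \<noteq> T \<Longrightarrow> convex hull S \<inter> convex hull T \<noteq> {}"
    and triple_in_P: "S \<in> SS \<Longrightarrow> T \<in> SS \<Longrightarrow> U \<in> SS \<Longrightarrow> S \<noteq> T \<Longrightarrow> S \<noteq> U \<Longrightarrow> T \<noteq> U \<Longrightarrow>
      convex hull S \<inter> convex hull T \<inter> convex hull U \<subseteq> P"
begin

lemma finS: "S \<in> SS \<Longrightarrow> finite S"
  using sub finP finite_subset by blast

lemma finSS: "finite SS"
  using sub finP by (meson PowI finite_Pow_iff finite_subset subsetI)

lemma general:
  assumes "a \<in> P" "b \<in> P" "c \<in> P" "a \<noteq> b" "a \<noteq> c" "wedge (b - a) (c - a) = 0"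
  shows "b = c"
  using gp[OF assms(1-5)] wedge_zero_collinear[OF assms(6)] by blast

text \<open>The ray from \<open>v\<close> to \<open>w\<close> fails to be free: some hull through
  \<open>v\<close> lies, apart from \<open>v\<close>, strictly to its right.\<close>

definition blocked :: "real^2 \<Rightarrow> real^2 \<Rightarrow> bool" where
  "blocked v w \<longleftrightarrow> (\<exists>Z\<in>SS. v \<in> Z \<and> (\<forall>x\<in>Z - {v}. wedge (w - v) (x - v) < 0))"

lemma not_both_blocked:
  assumes "v \<noteq> w" "blocked v w" "blocked w v"
  shows False
proof -
  obtain Z where Z: "Z \<in> SS" "v \<in> Z" "\<forall>x\<in>Z - {v}. wedge (w - v) (x - v) < 0"
    using assms(2) unfolding blocked_def by blast
  obtain Y where Y: "Y \<in> SS" "w \<in> Y" "\<forall>x\<in>Y - {w}. wedge (v - w) (x - w) < 0"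
    using assms(3) unfolding blocked_def by blast
  have "convex hull Z \<inter> convex hull Y = {}"
    using disjoint_hulls[OF assms(1)] Z Y by blast
  \<comment> \<open>This makes \<open>Z\<close> and \<open>Y\<close> different, as
    \<open>meet\<close> requires.\<close>
  moreover have "w \<notin> Z" using Z(3) assms(1) by force
  ultimately show False using meet[OF Z(1) Y(1)] Y(2) by blast
qed

text \<open>The direction \<open>q\<close> spans a supporting line at \<open>v\<close>. The two
  extreme directions among the points seen from \<open>v\<close> give the outgoing and the incoming
  edge.\<close>

lemma edges_at:
  assumes S: "S \<in> SS" and v: "v \<in> S" and q: "q \<noteq> 0" "\<And>x. x \<in> S \<Longrightarrow> 0 \<le> wedge q (x - v)"
  shows "\<exists>w. edge S v w" "\<exists>u. edge S u v"
proof -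
  let ?T = "(\<lambda>x. x - v) ` (S - {v})"
  have T: "finite ?T" using finS[OF S] by simp
  have "S \<noteq> {v}" using two[OF S] by auto
  then have ne: "?T \<noteq> {}" using v by auto
  have inj: "x = y" if "x \<in> ?T" "y \<in> ?T" "wedge x y = 0" for x y
  proof -
    obtain a b where "a \<in> S" "a \<noteq> v" "x = a - v" "b \<in> S" "b \<noteq> v" "y = b - v" using \<open>x \<in> ?T\<close> \<open>y \<in> ?T\<close> by blast
    then show ?thesis using general[of v a b] that(3) v sub[OF S] by blast
  qed
  have qpos: "0 \<le> 1 * wedge q x" if "x \<in> ?T" for x using that q(2) by auto
  have "\<exists>w\<in>?T. \<forall>x\<in>?T. 0 \<le> 1 * wedge w x"
    by (rule extreme_direction[OF T ne q(1) qpos _ inj]) simp_all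
  then obtain w where w: "w \<in> S" "w \<noteq> v" "\<forall>x\<in>S - {v}. 0 \<le> wedge (w - v) (x - v)" by auto
  have "0 \<le> wedge (w - v) (x - v)" if "x \<in> S" for x using w(3) that by (cases "x = v") auto
  then show "\<exists>w. edge S v w" unfolding edge_def using w v by blast
  \<comment> \<open>For the opposite extreme, negating both \<open>q\<close> and the sign leaves the
    half-plane hypothesis unchanged.\<close>
  have nz: "- q \<noteq> 0" using q(1) by simp
  have qneg: "0 \<le> - 1 * wedge (- q) x" if "x \<in> ?T" for x using that q(2) by (auto simp: wedge_def)
  have "\<exists>u\<in>?T. \<forall>x\<in>?T. 0 \<le> - 1 * wedge u x"
    by (rule extreme_direction[OF T ne nz qneg _ inj]) simp_all
  then obtain u where u: "u \<in> S" "u \<noteq> v" "\<forall>x\<in>S - {v}. wedge (u - v) (x - v) \<le> 0" by auto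
  have "wedge (u - v) (x - v) \<le> 0" if "x \<in> S" for x using u(3) that by (cases "x = v") auto
  then show "\<exists>u. edge S u v" unfolding edge_reverse using u v by blast
qed

text \<open>The line of the incoming edge supports the hull at \<open>v\<close>.\<close>

lemma edge_next:
  assumes "S \<in> SS" "edge S u v"
  shows "\<exists>w. edge S v w"
proof (rule edges_at(1)[OF assms(1), of v "v - u"])
  show "v \<in> S" "v - u \<noteq> 0" using assms(2) by (auto simp: edge_def)
  show "0 \<le> wedge (v - u) (x - v)" if "x \<in> S" for x
    using assms(2) that wedge_minus_left[of v u "x - v"] by (simp add: edge_reverse)
qed

lemma edge_prev: "S \<in> SS \<Longrightarrow> edge S v w \<Longrightarrow> \<exists>u. edge S u v"
  by (rule edges_at(2)[of S v "w - v"]) (auto simp: edge_def)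

lemma edge_unique_next:
  assumes "S \<in> SS" "edge S v w" "edge S v w'"
  shows "w = w'"
proof -
  have "0 \<le> wedge (w - v) (w' - v)" "0 \<le> wedge (w' - v) (w - v)" using assms by (auto simp: edge_def)
  then have "wedge (w - v) (w' - v) = 0" using wedge_swap[of "w - v" "w' - v"] by simp
  moreover have "v \<in> P" "w \<in> P" "w' \<in> P" "v \<noteq> w" "v \<noteq> w'" using assms sub by (auto simp: edge_def)
  ultimately show ?thesis using general by blast
qed

lemma edge_unique_prev:
  assumes "S \<in> SS" "edge S u v" "edge S u' v"
  shows "u = u'"
proof -
  have "wedge (u - v) (u' - v) \<le> 0" "wedge (u' - v) (u - v) \<le> 0" using assms by (auto simp: edge_reverse)
  then have "wedge (u - v) (u' - v) = 0" using wedge_swap[of "u - v" "u' - v"] by simp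
  moreover have "v \<in> P" "u \<in> P" "u' \<in> P" "v \<noteq> u" "v \<noteq> u'" using assms sub by (auto simp: edge_def)
  ultimately show ?thesis using general by blast
qed

lemma edge_back:
  assumes "S \<in> SS" "edge S v w" "edge S w v"
  shows "S = {v, w}"
proof -
  have "x = v \<or> x = w" if "x \<in> S" for x
  proof -
    have "0 \<le> wedge (w - v) (x - v)" using assms(2) that by (simp add: edge_def)
    moreover have "wedge (w - v) (x - v) \<le> 0" using assms(3) that by (simp add: edge_reverse)
    ultimately have "wedge (w - v) (x - v) = 0" by simp
    moreover have "v \<in> P" "w \<in> P" "x \<in> P" "v \<noteq> w"
      using assms(1,2) that sub by (auto simp: edge_def)
    ultimately show ?thesis using general by blast
  qed
  then show ?thesis using assms(2) by (auto simp: edge_def)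
qed

lemma edge_exists:
  assumes S: "S \<in> SS"
  shows "\<exists>v w. edge S v w"
proof -
  have "S \<noteq> {}" using two[OF S] by auto
  then obtain v where v: "v \<in> S" "\<forall>x\<in>S. v$1 \<le> x$1"
    using finS[OF S] by (meson arg_min_if_finite(1) arg_min_least)
  \<comment> \<open>At a leftmost point the vertical line, directed downwards, has the whole set on
    its left.\<close>
  let ?q = "vector [0, -1] :: real^2"
  have "?q \<noteq> 0" by (auto simp: vec_eq_iff forall_2)
  moreover have "0 \<le> wedge ?q (x - v)" if "x \<in> S" for x
    using v(2) that by (simp add: wedge_def)
  ultimately show ?thesis using edges_at(1)[OF S v(1)] by blast
qed

text \<open>Following the boundary for three steps gives edges with distinct tails, because a set
  with three points admits no immediate return. The third edge may close a triangle.\<close>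

lemma three_edges:
  assumes S: "S \<in> SS" and c: "3 \<le> card S"
  shows "3 \<le> card {(v, w). edge S v w}"
proof -
  have noback: "\<not> edge S w v" if "edge S v w" for v w
  proof
    assume "edge S w v"
    then have "S = {v, w}" using edge_back S that by blast
    then have "card S \<le> 2" using card_insert_le_m1[of 2 "{w}" v] by simp
    then show False using c by simp
  qed
  obtain v0 v1 where e0: "edge S v0 v1" using edge_exists[OF S] by blast
  obtain v2 where e1: "edge S v1 v2" using edge_next[OF S e0] by blast
  obtain v3 where e2: "edge S v2 v3" using edge_next[OF S e1] by blast
  have "v2 \<noteq> v0" using noback[OF e0] e1 by blast
  then have "card {(v0, v1), (v1, v2), (v2, v3)} = 3"
    using e0 e1 by (auto simp: edge_def)
  moreover have "{(v, w). edge S v w} \<subseteq> S \<times> S" by (auto simp: edge_def)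
  then have "finite {(v, w). edge S v w}" using finS[OF S] by (meson finite_SigmaI finite_subset)
  then have "card {(v0, v1), (v1, v2), (v2, v3)} \<le> card {(v, w). edge S v w}"
    by (rule card_mono) (use e0 e1 e2 in auto)
  ultimately show ?thesis by simp
qed

section \<open>Angles of the hulls at a common vertex\<close>

definition hulls_at :: "real^2 \<Rightarrow> (real^2) set set" where
  "hulls_at v = {S \<in> SS. \<exists>w. edge S v w}"

text \<open>At a vertex \<open>v\<close> the edges are unique, so the choices in \<open>succ\<close>
  and \<open>pred\<close> are forced. The angle of the hull at \<open>v\<close> runs
  counterclockwise from \<open>succ v S\<close> to \<open>pred v S\<close>.\<close>

definition succ :: "real^2 \<Rightarrow> (real^2) set \<Rightarrow> real^2" where
  "succ v S = (SOME w. edge S v w)"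

definition pred :: "real^2 \<Rightarrow> (real^2) set \<Rightarrow> real^2" where
  "pred v S = (SOME u. edge S u v)"

lemma succ_edge: "S \<in> hulls_at v \<Longrightarrow> edge S v (succ v S)"
  unfolding hulls_at_def succ_def by (auto intro: someI)

lemma pred_edge: "S \<in> hulls_at v \<Longrightarrow> edge S (pred v S) v"
  unfolding hulls_at_def pred_def using edge_prev by (auto intro: someI_ex)

lemma hulls_atD: "S \<in> hulls_at v \<Longrightarrow> S \<in> SS" "S \<in> hulls_at v \<Longrightarrow> v \<in> S" "S \<in> hulls_at v \<Longrightarrow> v \<in> P"
  using sub by (auto simp: hulls_at_def edge_def)

lemma succ_eq: "S \<in> SS \<Longrightarrow> edge S v w \<Longrightarrow> succ v S = w"
  using edge_unique_next succ_edge unfolding hulls_at_def by blast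

lemma pred_eq: "S \<in> SS \<Longrightarrow> edge S u v \<Longrightarrow> pred v S = u"
  using edge_unique_prev pred_edge edge_next unfolding hulls_at_def by blast

lemma same_direction:
  assumes "v \<in> P" "a \<in> P" "b \<in> P" "a \<noteq> v" "b \<noteq> v"
    "ang (a - v) = ang (b - v) \<or> \<bar>ang (a - v) - ang (b - v)\<bar> = pi"
  shows "a = b"
  using general[of v a b] wedge_zero_iff[of "a - v" "b - v"] assms by auto

lemma opposite_direction:
  assumes "v \<in> P" "a \<in> P" "b \<in> P" "a \<noteq> v" "b \<noteq> v"
  shows "\<bar>ang (a - v) - ang (b - v)\<bar> \<noteq> pi"
  using same_direction[OF assms] by auto

lemma succ_props: "S \<in> hulls_at v \<Longrightarrow> succ v S \<in> S \<and> succ v S \<in> P \<and> succ v S \<noteq> v"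
  using succ_edge[of S v] hulls_atD(1)[of S v] sub by (auto simp: edge_def)

lemma pred_props: "S \<in> hulls_at v \<Longrightarrow> pred v S \<in> S \<and> pred v S \<in> P \<and> pred v S \<noteq> v"
  using pred_edge[of S v] hulls_atD(1)[of S v] sub by (auto simp: edge_def)

lemma arc_at:
  assumes "S \<in> hulls_at v"
  shows "ang (succ v S - v) = ang (pred v S - v) \<or> ahead (ang (succ v S - v)) (ang (pred v S - v))"
proof -
  have "0 \<le> wedge (succ v S - v) (pred v S - v)"
    using succ_edge[OF assms] pred_props[OF assms] by (auto simp: edge_def)
  then show ?thesis
    using wedge_pos_iff[of "succ v S - v" "pred v S - v"] general[of v "succ v S" "pred v S"]
      succ_props[OF assms] pred_props[OF assms] hulls_atD(3)[OF assms] by fastforce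
qed

text \<open>A direction in the arc is a nonnegative combination of the two edge vectors, so a short
  step along it stays in the triangle spanned by \<open>v\<close> and its two neighbours.\<close>

lemma hull_contains_germ:
  assumes S: "S \<in> hulls_at v" and p: "0 \<le> p" "p < 2 * pi"
    and "ang (succ v S - v) = p \<or> ahead (ang (succ v S - v)) p"
    and "p = ang (pred v S - v) \<or> ahead p (ang (pred v S - v))"
  shows "\<exists>\<epsilon>>0. \<forall>t\<in>{0..\<epsilon>}. v + t *\<^sub>R dir p \<in> convex hull S"
proof -
  have nz: "succ v S - v \<noteq> 0" "pred v S - v \<noteq> 0" using succ_props[OF S] pred_props[OF S] by auto
  obtain \<alpha> \<beta> where ab: "\<alpha> \<ge> 0" "\<beta> \<ge> 0" "dir p = \<alpha> *\<^sub>R (succ v S - v) + \<beta> *\<^sub>R (pred v S - v)"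
    using cone_contains_dir[OF nz p arc_at[OF S] assms(4,5)] .
  \<comment> \<open>This bound keeps the coefficient of \<open>v\<close> nonnegative; the summand 1
    avoids division by zero.\<close>
  define \<epsilon> where "\<epsilon> = 1 / (\<alpha> + \<beta> + 1)"
  have "v + t *\<^sub>R dir p \<in> convex hull S" if t: "t \<in> {0..\<epsilon>}" for t
  proof -
    have "t * (\<alpha> + \<beta> + 1) \<le> 1" using t ab by (simp add: \<epsilon>_def field_simps)
    then have "0 \<le> 1 - t * \<alpha> - t * \<beta>" using t by (auto simp: algebra_simps)
    then have "(1 - t * \<alpha> - t * \<beta>) *\<^sub>R v + (t * \<alpha>) *\<^sub>R succ v S + (t * \<beta>) *\<^sub>R pred v S \<in> convex hull {v, succ v S, pred v S}"
      unfolding convex_hull_3 using t ab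
      by (intro CollectI exI[of _ "1 - t * \<alpha> - t * \<beta>"] exI[of _ "t * \<alpha>"] exI[of _ "t * \<beta>"] conjI) simp_all
    moreover have "(1 - t * \<alpha> - t * \<beta>) *\<^sub>R v + (t * \<alpha>) *\<^sub>R succ v S + (t * \<beta>) *\<^sub>R pred v S = v + t *\<^sub>R dir p"
      unfolding ab(3) by (simp add: algebra_simps)
    moreover have "convex hull {v, succ v S, pred v S} \<subseteq> convex hull S"
      using hulls_atD(2)[OF S] succ_props[OF S] pred_props[OF S] by (intro hull_mono) auto
    ultimately show ?thesis by auto
  qed
  moreover have "\<epsilon> > 0" using ab by (simp add: \<epsilon>_def)
  ultimately show ?thesis by blast
qed

text \<open>Three hulls sharing a short segment would have infinitely many common points, all in the
  finite set \<open>P\<close>.\<close>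

lemma no_common_germ:
  assumes "S \<in> SS" "T \<in> SS" "U \<in> SS" "S \<noteq> T" "S \<noteq> U" "T \<noteq> U" "d \<noteq> 0"
    and "\<exists>\<epsilon>>0. \<forall>t\<in>{0..\<epsilon>}. v + t *\<^sub>R d \<in> convex hull S"
    "\<exists>\<epsilon>>0. \<forall>t\<in>{0..\<epsilon>}. v + t *\<^sub>R d \<in> convex hull T"
    "\<exists>\<epsilon>>0. \<forall>t\<in>{0..\<epsilon>}. v + t *\<^sub>R d \<in> convex hull U"
  shows False
proof -
  obtain x y z where e: "x > 0" "y > 0" "z > (0::real)"
    "\<forall>t\<in>{0..x}. v + t *\<^sub>R d \<in> convex hull S"
    "\<forall>t\<in>{0..y}. v + t *\<^sub>R d \<in> convex hull T"
    "\<forall>t\<in>{0..z}. v + t *\<^sub>R d \<in> convex hull U" using assms(8-10) by blast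
  define m where "m = min x (min y z)"
  have "(\<lambda>t. v + t *\<^sub>R d) ` {0..m} \<subseteq> P"
    using triple_in_P[OF assms(1-6)] e by (force simp: m_def)
  then have "finite ((\<lambda>t. v + t *\<^sub>R d) ` {0..m})" using finP finite_subset by blast
  moreover have "inj_on (\<lambda>t. v + t *\<^sub>R d) {0..m}" using assms(7) by (auto simp: inj_on_def)
  ultimately have "finite {0..m}" using finite_imageD by blast
  moreover have "m > 0" using e by (simp add: m_def)
  ultimately show False by (simp add: infinite_Icc)
qed

lemma degenerate_at:
  assumes "S \<in> hulls_at v" "ang (succ v S - v) = ang (pred v S - v)"
  shows "S = {v, succ v S}"
proof -
  have "succ v S = pred v S"
    using same_direction assms hulls_atD(3) succ_props pred_props by metis
  then show ?thesis using edge_back succ_edge pred_edge assms(1) hulls_atD(1) by metis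
qed

text \<open>By general position a point of \<open>T\<close> in the direction of the segment is its
  other endpoint, so \<open>T\<close> contains \<open>S\<close>, against non-inclusion.\<close>

lemma segment_not_extended:
  assumes "S \<in> hulls_at v" "ang (succ v S - v) = ang (pred v S - v)" "T \<in> SS" "T \<noteq> S" "v \<in> T"
    "a \<in> T" "a \<noteq> v"
  shows "ang (a - v) \<noteq> ang (succ v S - v)"
proof
  assume "ang (a - v) = ang (succ v S - v)"
  then have "a = succ v S"
    using same_direction[of v a "succ v S"] assms hulls_atD(3)[OF assms(1)] succ_props[OF assms(1)] sub by blast
  then have "S \<subseteq> {v, a}" using equalityD1[OF degenerate_at[OF assms(1,2)]] by simp
  then have "S \<subseteq> T" using assms(5,6) by blast
  then have "convex hull S \<subseteq> convex hull T" by (rule hull_mono)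
  then show False using noincl[OF hulls_atD(1)[OF assms(1)] assms(3)] assms(4) by blast
qed

text \<open>The thrackle conditions enter here: triple intersections give \<open>depth\<close>,
  non-inclusion gives \<open>degenerate\<close>, and general position excludes opposite
  directions.\<close>

sublocale at: arc_system "hulls_at v" "\<lambda>S. ang (succ v S - v)" "\<lambda>S. ang (pred v S - v)" for v
proof
  show "finite (hulls_at v)" using finSS by (simp add: hulls_at_def)
next
  fix S T U p
  assume A: "S \<in> hulls_at v" "T \<in> hulls_at v" "U \<in> hulls_at v" and ne: "S \<noteq> T" "S \<noteq> U" "T \<noteq> U"
    and p: "0 \<le> p" "p < 2 * pi"
  show "\<exists>l\<in>{S, T, U}. \<not> ((ang (succ v l - v) = p \<or> ahead (ang (succ v l - v)) p) \<and>
      (p = ang (pred v l - v) \<or> ahead p (ang (pred v l - v))))"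
  proof (rule ccontr)
    assume n: "\<not> ?thesis"
    have g: "\<exists>\<epsilon>>0. \<forall>t\<in>{0..\<epsilon>}. v + t *\<^sub>R dir p \<in> convex hull l" if "l \<in> {S, T, U}" for l
    proof (rule hull_contains_germ[OF _ p])
      show "l \<in> hulls_at v" using that A by blast
    qed (use n that in blast)+
    show False
      by (rule no_common_germ[OF hulls_atD(1)[OF A(1)] hulls_atD(1)[OF A(2)] hulls_atD(1)[OF A(3)] ne dir_nonzero
            g g g]) simp_all
  qed
next
  fix S T
  assume A: "S \<in> hulls_at v" "ang (succ v S - v) = ang (pred v S - v)" "T \<in> hulls_at v" "T \<noteq> S"
  show "ang (succ v T - v) \<noteq> ang (succ v S - v) \<and> ang (pred v T - v) \<noteq> ang (succ v S - v)"
    using segment_not_extended[OF A(1,2) _ A(4)] hulls_atD[OF A(3)] succ_props[OF A(3)] pred_props[OF A(3)] by blast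
next
  fix S T
  assume S: "S \<in> hulls_at v" and T: "T \<in> hulls_at v"
  note props = hulls_atD(3)[OF S] succ_props[OF S] pred_props[OF S] succ_props[OF T] pred_props[OF T]
  show "\<bar>ang (succ v S - v) - ang (succ v T - v)\<bar> \<noteq> pi"
    "\<bar>ang (succ v S - v) - ang (pred v T - v)\<bar> \<noteq> pi"
    "\<bar>ang (pred v S - v) - ang (pred v T - v)\<bar> \<noteq> pi"
    by (rule opposite_direction; use props in blast)+
qed (simp_all add: ang_range arc_at)

text \<open>If both neighbours of \<open>v\<close> lie strictly right of the ray, so does all of
  \<open>S\<close> apart from \<open>v\<close>, because \<open>S\<close> lies in the cone that they
  span at \<open>v\<close>.\<close>

lemma free_if_not_blocked:
  assumes "v \<in> P" "w \<in> P" "v \<noteq> w" "\<not> blocked v w"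
  shows "at.free v (ang (w - v))"
  unfolding at.free_def
proof (intro ballI notI)
  fix S
  assume S: "S \<in> hulls_at v"
    and A: "ahead (ang (succ v S - v)) (ang (w - v)) \<and> ahead (ang (pred v S - v)) (ang (w - v))"
  define a b y where "a = succ v S - v" and "b = pred v S - v" and "y = w - v"
  have "wedge a y > 0" "wedge b y > 0"
    using A wedge_pos_iff[of _ "w - v"] assms(3) succ_props[OF S] pred_props[OF S] by (auto simp: a_def b_def y_def)
  then have ab: "wedge y a < 0" "wedge y b < 0" using wedge_swap[of y] by auto
  have "wedge y (x - v) < 0" if x: "x \<in> S - {v}" for x
  proof (cases "wedge a b = 0")
    case True
    then have "succ v S = pred v S"
      using general[of v "succ v S" "pred v S"] succ_props[OF S] pred_props[OF S] hulls_atD(3)[OF S]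
      by (auto simp: a_def b_def)
    then have "S \<subseteq> {v, succ v S}" by (intro equalityD1[OF degenerate_at[OF S]]) simp
    then have "x = succ v S" using x by blast
    then have "x - v = a" by (simp add: a_def)
    then show ?thesis using ab by simp
  next
    case False
    have ax: "0 \<le> wedge a (x - v)" using succ_edge[OF S] x by (auto simp: a_def edge_def)
    have bx: "wedge b (x - v) \<le> 0" using pred_edge[OF S] x by (auto simp: b_def edge_reverse)
    have "0 \<le> wedge a b" using succ_edge[OF S] pred_props[OF S] by (auto simp: a_def b_def edge_def)
    then have pos: "0 < wedge a b" using False by simp
    have "wedge a (x - v) \<noteq> 0 \<or> wedge b (x - v) \<noteq> 0"
      using general[of v "succ v S" x] general[of v "pred v S" x] False x succ_props[OF S] pred_props[OF S]
        hulls_atD(3)[OF S] sub[OF hulls_atD(1)[OF S]] by (auto simp: a_def b_def)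
    \<comment> \<open>These are the terms obtained by expanding \<open>x - v\<close> in
      \<open>a\<close> and \<open>b\<close> with Cramer's rule. The coefficients are nonnegative and
      do not both vanish.\<close>
    then have "wedge y a * - wedge b (x - v) + wedge y b * wedge a (x - v) < 0"
      using ab ax bx by (smt (verit) mult_neg_pos mult_nonpos_nonneg)
    moreover have "wedge a b * wedge y (x - v) = wedge y a * - wedge b (x - v) + wedge y b * wedge a (x - v)"
      by (simp add: wedge_def algebra_simps)
    ultimately show ?thesis using pos by (smt (verit) mult_nonneg_nonneg)
  qed
  then have "blocked v w"
    unfolding blocked_def y_def using hulls_atD[OF S] by blast
  then show False using assms(4) by blast
qed

text \<open>A segment is free from one of its endpoints and gets weight 3 there. For a larger set
  each of at least three edges has a free orientation: the forward one counts as a start at its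
  tail, the backward one as an end at its head.\<close>

lemma hull_weight:
  assumes S: "S \<in> SS"
  shows "3 \<le> 3 * card {v \<in> P. S \<in> at.segs v} + card {v \<in> P. S \<in> at.starts v} + card {v \<in> P. S \<in> at.ends v}"
proof (cases "card S = 2")
  case True
  have *: "a \<in> {v \<in> P. S \<in> at.segs v}" if ab: "S = {a, b}" "a \<noteq> b" "\<not> blocked a b" for a b
  proof -
    have P: "a \<in> P" "b \<in> P" using sub[OF S] ab by auto
    have e: "edge S a b" "edge S b a" using ab by (auto simp: edge_def wedge_def)
    have "S \<in> hulls_at a" using S e by (auto simp: hulls_at_def)
    then show ?thesis
      using free_if_not_blocked[OF P ab(2,3)] P(1) succ_eq[OF S e(1)] pred_eq[OF S e(2)]
      by (simp add: at.segs_def)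
  qed
  obtain a b where ab: "S = {a, b}" "a \<noteq> b" using True by (auto simp: card_2_iff)
  then have "{v \<in> P. S \<in> at.segs v} \<noteq> {}"
    using *[of a b] *[of b a] not_both_blocked[of a b] by blast
  then have "1 \<le> card {v \<in> P. S \<in> at.segs v}"
    using finP by (simp add: Suc_le_eq card_gt_0_iff)
  then show ?thesis by simp
next
  case False
  then have c3: "3 \<le> card S" using two[OF S] by simp
  have nd: "ang (succ v S - v) \<noteq> ang (pred v S - v)" if "S \<in> hulls_at v" for v
  proof
    assume "ang (succ v S - v) = ang (pred v S - v)"
    then have "card S = card {v, succ v S}" by (intro arg_cong[OF degenerate_at[OF that]])
    then show False using c3 card_insert_le_m1[of 2 "{succ v S}" v] by simp
  qed
  let ?E = "{(v, w). edge S v w}"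
  let ?A = "{(v, w). edge S v w \<and> \<not> blocked v w}"
  let ?B = "{(v, w). edge S v w \<and> \<not> blocked w v}"
  have "?E \<subseteq> S \<times> S" by (auto simp: edge_def)
  then have "finite ?E" using finS[OF S] by (meson finite_SigmaI finite_subset)
  then have fin: "finite ?A" "finite ?B" by (auto intro: finite_subset[of _ ?E])
  have "?E \<subseteq> ?A \<union> ?B" using not_both_blocked by (auto simp: edge_def)
  then have "card ?E \<le> card (?A \<union> ?B)" using fin by (intro card_mono) auto
  then have "3 \<le> card ?A + card ?B" using three_edges[OF S c3] card_Un_le[of ?A ?B] by linarith
  moreover have "card ?A \<le> card {v \<in> P. S \<in> at.starts v}"
  proof (rule card_inj_on_le[of fst])
    show "inj_on fst ?A" using edge_unique_next[OF S] by (auto simp: inj_on_def)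
    have "v \<in> P \<and> S \<in> at.starts v" if e: "edge S v w" "\<not> blocked v w" for v w
    proof -
      have P: "v \<in> P" "w \<in> P" "v \<noteq> w" using e sub[OF S] by (auto simp: edge_def)
      have "S \<in> hulls_at v" using S e by (auto simp: hulls_at_def)
      then show ?thesis
        using free_if_not_blocked[OF P e(2)] nd[of v] P(1) succ_eq[OF S e(1)] by (simp add: at.starts_def)
    qed
    then show "fst ` ?A \<subseteq> {v \<in> P. S \<in> at.starts v}" by auto
  qed (use finP in simp)
  moreover have "card ?B \<le> card {v \<in> P. S \<in> at.ends v}"
  proof (rule card_inj_on_le[of snd])
    show "inj_on snd ?B" using edge_unique_prev[OF S] by (auto simp: inj_on_def)
    have "w \<in> P \<and> S \<in> at.ends w" if e: "edge S v w" "\<not> blocked w v" for v w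
    proof -
      have P: "w \<in> P" "v \<in> P" "w \<noteq> v" using e sub[OF S] by (auto simp: edge_def)
      have "S \<in> hulls_at w" using S edge_next[OF S e(1)] by (auto simp: hulls_at_def)
      then show ?thesis
        using free_if_not_blocked[OF P e(2)] nd[of w] P(1) pred_eq[OF S e(1)] by (simp add: at.ends_def)
    qed
    then show "snd ` ?B \<subseteq> {v \<in> P. S \<in> at.ends v}" by auto
  qed (use finP in simp)
  ultimately show ?thesis by linarith
qed

section \<open>Summation over hulls and vertices\<close>

lemma double_count:
  assumes "\<And>v. X v \<subseteq> SS"
  shows "(\<Sum>S\<in>SS. card {v \<in> P. S \<in> X v}) = (\<Sum>v\<in>P. card (X v))"
proof -
  have "(\<Sum>S\<in>SS. card {v \<in> P. S \<in> X v}) = (\<Sum>v\<in>P. card {S \<in> SS. S \<in> X v})"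
    by (rule sum_multicount_gen) (use finP finSS in auto)
  moreover have "{S \<in> SS. S \<in> X v} = X v" for v using assms by blast
  ultimately show ?thesis by simp
qed

theorem card_bound: "card SS \<le> 2 * card P"
proof -
  have X: "at.segs v \<subseteq> SS" "at.starts v \<subseteq> SS" "at.ends v \<subseteq> SS" for v
    using hulls_atD(1) by (auto simp: at.segs_def at.starts_def at.ends_def)
  have "3 * card SS = (\<Sum>S\<in>SS. 3)" by simp
  also have "\<dots> \<le> (\<Sum>S\<in>SS. 3 * card {v \<in> P. S \<in> at.segs v} +
      card {v \<in> P. S \<in> at.starts v} + card {v \<in> P. S \<in> at.ends v})"
    by (rule sum_mono) (rule hull_weight)
  also have "\<dots> = (\<Sum>v\<in>P. 3 * card (at.segs v) + card (at.starts v) + card (at.ends v))"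
    by (simp add: sum.distrib double_count X flip: sum_distrib_left)
  also have "\<dots> \<le> (\<Sum>v\<in>P. 6)"
    by (rule sum_mono) (rule at.weight_le_6)
  finally show ?thesis by simp
qed

end

theorem theorem3:
  fixes P :: "(real^2) set" and \<S> :: "(real^2) set set" and n :: nat
  assumes "finite P" and "card P = n" and "n \<ge> 1"
    and "in_general_position P"
    and "\<S> \<subseteq> Pow P"
    and "inj_on (\<lambda>S. convex hull S) \<S>"
    and "convex_hull_thrackle P (convex_hulls \<S>)"
  shows "card \<S> \<le> 2 * n"
proof -
  have inj: "convex hull S \<noteq> convex hull T" if "S \<in> \<S>" "T \<in> \<S>" "S \<noteq> T" for S T
    using assms(6) that by (auto simp: inj_on_def)
  have hull: "convex hull S \<in> convex_hulls \<S>" if "S \<in> \<S>" for S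
    using that by (simp add: convex_hulls_def)
  note thrackle = assms(7)[unfolded convex_hull_thrackle_def]
  have incl: "\<not> convex hull S \<subseteq> convex hull T" if "S \<in> \<S>" "T \<in> \<S>" "S \<noteq> T" for S T
    using thrackle[THEN conjunct1] hull[OF that(1)] hull[OF that(2)] inj[OF that] by simp
  have meet: "convex hull S \<inter> convex hull T \<noteq> {}" if "S \<in> \<S>" "T \<in> \<S>" "S \<noteq> T" for S T
    using thrackle[THEN conjunct2, THEN conjunct1] hull[OF that(1)] hull[OF that(2)] inj[OF that] by simp
  have triple: "convex hull S \<inter> convex hull T \<inter> convex hull U \<subseteq> P"
    if "S \<in> \<S>" "T \<in> \<S>" "U \<in> \<S>" "S \<noteq> T" "S \<noteq> U" "T \<noteq> U" for S T U
    using thrackle[THEN conjunct2, THEN conjunct2, rule_format, OF hull[OF that(1)] hull[OF that(2)] hull[OF that(3)]]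
      inj[OF that(1,2,4)] inj[OF that(1,3,5)] inj[OF that(2,3,6)] by blast
  have fin: "finite S" if "S \<in> \<S>" for S
    using assms(1,5) that finite_subset by blast
  show ?thesis
  proof (cases "\<exists>S\<in>\<S>. card S < 2")
    case True
    then obtain S where S: "S \<in> \<S>" "card S < 2" by blast
    \<comment> \<open>The empty hull lies in every hull, and a one-point hull lies in every hull
      that it meets. A set with fewer than two points is thus the only member, and 1 \<le> 2
      n.\<close>
    have "T = S" if T: "T \<in> \<S>" for T
    proof (rule ccontr)
      assume ne: "T \<noteq> S"
      have "S = {} \<or> (\<exists>v. S = {v})"
        using S(2) fin[OF S(1)] card_1_singletonE[of S] by (cases "card S") auto
      then show False
      proof
        assume "S = {}"
        then show False using incl[OF S(1) T] ne by simp
      next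
        assume "\<exists>v. S = {v}"
        then obtain v where "S = {v}" ..
        then show False using meet[OF S(1) T] incl[OF S(1) T] ne by simp
      qed
    qed
    then have "\<S> = {S}" using S by blast
    then show ?thesis using assms(3) by simp
  next
    case False
    interpret hull_thrackle P \<S>
    proof
      show "2 \<le> card S" if "S \<in> \<S>" for S using False that by force
      show "\<not> collinear {a, b, c}" if "a \<in> P" "b \<in> P" "c \<in> P" "a \<noteq> b" "a \<noteq> c" "b \<noteq> c" for a b c
        using assms(4) that unfolding in_general_position_def by blast
    qed (use assms(1,5) incl meet triple in auto)
    show ?thesis using card_bound assms(2) by simp
  qed
qed

end
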